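(* Let $L\in\mathcal L^{\mathrm{exact}}$, i.e. $L$ is a policy-permitted leverage tier with $\Psi(L)\ge0$. Suppose that at the hard-flat decision time $u=u(L)$, with horizon $\Delta=\Delta(L)$, buffer $m(L)$ and position quantity $q_0(L)$: the realized path $\omega$ belongs to the operating set $\mathcal U^{\mathrm{op}}_u(\Delta)$; the actual market close satisfies $T_c^{\mathrm{act}}(\omega)>u+\Delta$; execution authority, collateral non-escape with loan priority, and settlement observability and finality hold on $[u,u+\Delta]$; the policy submits risk-reducing sales, applies every confirmed net proceed debt-first, and continues until the debt is zero or the cumulative settled quantity reaches the planned cap, with every submitted fill it uses settling by $u+\Delta$; and no new borrowing is created after $u$. Then the entire position quantity $q_0(L)$ is sufficient to clear the debt and the buffer inside the registered operating set.
   Context: Entry. A user contributes collateral $C>0$ and requests leverage $L\ge1$, giving budget $LC$ and initial debt $(L-1)C$. $A^{\mathrm{set}}_{t_0}(q)$ is the confirmed cost of acquiring $q$ tokens: non-decreasing on the admissible entry lot set $\mathcal Q^{\mathrm{buy}}_{t_0}$ with $A^{\mathrm{set}}_{t_0}(0)=0$. Entry quantity and residual cash are $q_0(L)=\max\{q\in\mathcal Q^{\mathrm{buy}}_{t_0}:A^{\mathrm{set}}_{t_0}(q)\le LC\}$ and $K_0(L)=LC-A^{\mathrm{set}}_{t_0}(q_0(L))\ge0$; $K_0(L)$ is the dedicated cash of the position. Exit. For an execution policy $\Pi$, decision time $u$ and horizon $\Delta$, $B^{\mathrm{set},\Pi}_{u,\Delta}(x,\omega)$ is the net sale proceeds confirmed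 and available for debt repayment by $u+\Delta$ on path $\omega$ when the policy is run against cumulative sale cap $x$, and $\underline B^{\Pi}_{u,\Delta}(x)=\inf_{\omega\in\mathcal U^{\mathrm{op}}_u(\Delta)}B^{\mathrm{set},\Pi}_{u,\Delta}(x,\omega)$, where $\mathcal U^{\mathrm{op}}_u(\Delta)\subseteq\Omega$ is the registered operating set of paths. Debt. With $P_{u,t}$ the cumulative confirmed cash applied to the loan after $u$ and up to $t$, $D_t=[D_u+\int_u^t r_sD_s\,ds+C^{\mathrm{debt}}_{u,t}-P_{u,t}]^+$ until extinction ($r_s\ge0$ borrowing rate, $C^{\mathrm{debt}}_{u,t}$ added charges). The debt-service upper envelope is $\overline H_{u,\Delta}=\sup_{\omega\in\mathcal U^{\mathrm{op}}_u(\Delta)}\big(P_{u,u+\Delta}(\omega)+D_{u+\Delta}(\omega)\big)$; $\overline H_{u(L),\Delta(L)}(L)$ is this quantity for the loan at leverage $L$. Feasibility. $\Psi(L)=K_0(L)+\underline B^{\Pi}_{u(L),\Delta(L)}(q_0(L))-\overline H_{u(L),\Delta(L)}(L)-m(L)$, where $m(L)\ge0$ is the hard-flat buffer. For a finite set $\mathcal L_{\mathrm{policy}}$ of permitted leverage tiers, $\mathcal L^{\mathrm{exact}}=\{L\in\mathcal L_{\mathrm{policy}}:\Psi(L)\ge0\}$. The planned cap is the smallest admissible grid quantity $x\le q_0(L)$ with $K_0(L)+\underline B^{\Pi}_{u,\Delta}(x)\ge\overline H_{u,\Delta}+m(L)$; the full quantity $q_0(L)$ is an admissible sale quantity. Named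 conditions. Debt-first: each confirmed increment $\Delta b$ arriving when debt is $D$ and cash is $K$ triggers payment $\min\{D,K+\Delta b\}$. Execution authority: while debt is positive the controller can submit, replace, cancel and settle risk-reducing orders without new borrower consent. Collateral non-escape and loan priority: while debt is positive the borrower cannot remove the financed tokens or dedicated cash, and settled proceeds go to the loan first. Settlement observability and finality: finalized fills are identifiable, and only confirmed, non-reversible receipts reduce debt. $T_c^{\mathrm{act}}$ is the first time at which risk-reducing orders are no longer accepted.
   Formalization: Debt-first is supplemented: if the dedicated cash is positive, it is tendered to the loan at some time in (u,u+Δ], even without a sale receipt; otherwise, with planned cap 0 and no receipts, the debt could stay unpaid. *)

theory Defs
  imports "HOL-Analysis.Analysis"
begin

text \<open>
  Times, quantities and amounts of cash are real numbers; the path space is the type \<open>'w\<close>.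
  The time \<open>settle_time\<close> of a fill is the time at which its receipt is confirmed and non-reversible,
  and \<open>net_proceeds\<close> is that receipt net of all execution costs. The field \<open>fill_id\<close> only keeps
  otherwise equal fills apart in a set of fills.
\<close>

record fill =
  fill_id :: nat
  submit_time :: real
  settle_time :: real
  fill_qty :: real
  net_proceeds :: real

datatype order_action = Submit | Replace | Cancel | Settle

text \<open>
  The first argument of the loan-dependent fields is the leverage \<open>L\<close>.

  \<^item> \<open>program M u \<Delta> x \<omega>\<close> is the set of risk-reducing fills that the execution policy obtains on \<open>\<omega>\<close>
    when it is run from \<open>u\<close> with horizon \<open>\<Delta>\<close> against the cumulative sale cap \<open>x\<close>, debt being ignored.
  \<^item> \<open>charges M L \<omega> t\<close> is the total of the charges added to the loan after the decision time
    \<open>u(L)\<close> and up to \<open>t\<close>.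
  \<^item> \<open>pay_times\<close> is the set of times at which cash is applied to the loan, \<open>pay\<close> the amount applied.
  \<^item> \<open>submitted\<close>: fills of the program that the controller really submits for; \<open>credited\<close>: fills
    that are recognised as received on the position account.
  \<^item> \<open>tender_time\<close> is the time at which the dedicated cash is made available to the loan.
  \<^item> \<open>cash_out M L \<omega> t\<close>: cash that has left the position account after \<open>u(L)\<close> and strictly before
    \<open>t\<close> other than to the loan, whether dedicated cash or sale proceeds. \<open>tokens_out\<close> likewise, for
    financed tokens removed other than by sale.
  \<^item> \<open>authorised M L \<omega> t a\<close>: at time \<open>t\<close> the controller can perform the action \<open>a\<close> on
    risk-reducing orders without new borrower consent.
\<close>

record 'w market =
  collateral :: real
  entry_time :: real
  buy_lots :: "real set"
  acq_cost :: "real \<Rightarrow> real"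
  tiers :: "real set"
  decision_time :: "real \<Rightarrow> real"
  horizon :: "real \<Rightarrow> real"
  buffer :: "real \<Rightarrow> real"
  sale_grid :: "real set"
  program :: "real \<Rightarrow> real \<Rightarrow> real \<Rightarrow> 'w \<Rightarrow> fill set"
  op_set :: "real \<Rightarrow> real \<Rightarrow> 'w set"
  accepts :: "'w \<Rightarrow> real \<Rightarrow> bool"
  rate :: "'w \<Rightarrow> real \<Rightarrow> real"
  debt :: "real \<Rightarrow> 'w \<Rightarrow> real \<Rightarrow> real"
  charges :: "real \<Rightarrow> 'w \<Rightarrow> real \<Rightarrow> real"
  pay_times :: "real \<Rightarrow> 'w \<Rightarrow> real set"
  pay :: "real \<Rightarrow> 'w \<Rightarrow> real \<Rightarrow> real"
  submitted :: "real \<Rightarrow> 'w \<Rightarrow> fill set"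
  credited :: "real \<Rightarrow> 'w \<Rightarrow> fill set"
  tender_time :: "real \<Rightarrow> 'w \<Rightarrow> real"
  cash_out :: "real \<Rightarrow> 'w \<Rightarrow> real \<Rightarrow> real"
  tokens_out :: "real \<Rightarrow> 'w \<Rightarrow> real \<Rightarrow> real"
  authorised :: "real \<Rightarrow> 'w \<Rightarrow> real \<Rightarrow> order_action \<Rightarrow> bool"

section \<open>Entry\<close>

definition q0 :: "'w market \<Rightarrow> real \<Rightarrow> real" where
  "q0 M L = (GREATEST q. q \<in> buy_lots M \<and> acq_cost M q \<le> L * collateral M)"

definition K0 :: "'w market \<Rightarrow> real \<Rightarrow> real" where
  "K0 M L = L * collateral M - acq_cost M (q0 M L)"

definition entry_wf :: "'w market \<Rightarrow> bool" where
  "entry_wf M \<longleftrightarrow>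
     0 < collateral M \<and>
     finite (tiers M) \<and> (\<forall>L\<in>tiers M. 1 \<le> L) \<and>
     0 \<in> buy_lots M \<and> buy_lots M \<subseteq> {0..} \<and>
     mono_on (buy_lots M) (acq_cost M) \<and> acq_cost M 0 = 0 \<and>
     (\<forall>L\<in>tiers M. \<exists>q\<in>buy_lots M. acq_cost M q \<le> L * collateral M \<and>
        (\<forall>q'\<in>buy_lots M. acq_cost M q' \<le> L * collateral M \<longrightarrow> q' \<le> q))"

section \<open>Exit\<close>

definition B_set :: "'w market \<Rightarrow> real \<Rightarrow> real \<Rightarrow> real \<Rightarrow> 'w \<Rightarrow> real" where
  "B_set M u \<Delta> x \<omega> =
     (\<Sum>f\<in>{f \<in> program M u \<Delta> x \<omega>. settle_time f \<le> u + \<Delta>}. net_proceeds f)"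

text \<open>
  Envelopes are extended reals, so that no boundedness has to be assumed. For a nonempty operating
  set the lower envelope is not \<open>\<infinity>\<close> and the debt-service envelope below is not \<open>-\<infinity>\<close>, hence
  \<open>\<infinity> - \<infinity>\<close> does not occur in the feasibility function.
\<close>

definition B_low :: "'w market \<Rightarrow> real \<Rightarrow> real \<Rightarrow> real \<Rightarrow> ereal" where
  "B_low M u \<Delta> x = (INF \<omega>\<in>op_set M u \<Delta>. ereal (B_set M u \<Delta> x \<omega>))"

definition exit_wf :: "'w market \<Rightarrow> bool" where
  "exit_wf M \<longleftrightarrow>
     sale_grid M \<subseteq> {0..} \<and> (\<forall>c. finite {x \<in> sale_grid M. x \<le> c}) \<and>
     (\<forall>L\<in>tiers M.
        entry_time M \<le> decision_time M L \<and> 0 \<le> horizon M L \<and> 0 \<le> buffer M L \<and>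
        q0 M L \<in> sale_grid M \<and>
        (\<forall>x\<in>sale_grid M. \<forall>\<omega>.
           let F = program M (decision_time M L) (horizon M L) x \<omega> in
             finite F \<and> (\<Sum>f\<in>F. fill_qty f) \<le> x \<and>
             (\<forall>f\<in>F. 0 < fill_qty f \<and> decision_time M L \<le> submit_time f \<and>
                     submit_time f \<le> settle_time f \<and> decision_time M L < settle_time f)))"

text \<open>
  The market close: the first time from entry on at which risk-reducing orders are no longer
  accepted, \<open>\<infinity>\<close> if there is none.
\<close>

definition T_close :: "'w market \<Rightarrow> 'w \<Rightarrow> ereal" where
  "T_close M \<omega> = (INF t\<in>{t. entry_time M \<le> t \<and> \<not> accepts M \<omega> t}. ereal t)"

section \<open>Debt\<close>

definition paid :: "'w market \<Rightarrow> real \<Rightarrow> 'w \<Rightarrow> real \<Rightarrow> real" where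
  "paid M L \<omega> t = (\<Sum>s\<in>pay_times M L \<omega> \<inter> {decision_time M L<..t}. pay M L \<omega> s)"

definition paid_before :: "'w market \<Rightarrow> real \<Rightarrow> 'w \<Rightarrow> real \<Rightarrow> real" where
  "paid_before M L \<omega> t = (\<Sum>s\<in>pay_times M L \<omega> \<inter> {decision_time M L<..<t}. pay M L \<omega> s)"

definition gross_debt :: "'w market \<Rightarrow> real \<Rightarrow> 'w \<Rightarrow> real \<Rightarrow> real" where
  "gross_debt M L \<omega> t =
     debt M L \<omega> (decision_time M L) +
     integral {decision_time M L..t} (\<lambda>s. rate M \<omega> s * debt M L \<omega> s) + charges M L \<omega> t"

definition positive_until :: "'w market \<Rightarrow> real \<Rightarrow> 'w \<Rightarrow> real \<Rightarrow> bool" where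
  "positive_until M L \<omega> t \<longleftrightarrow> (\<forall>s\<in>{decision_time M L..<t}. 0 < debt M L \<omega> s)"

text \<open>The debt identity is imposed up to and including the time of extinction only.\<close>

definition debt_wf :: "'w market \<Rightarrow> bool" where
  "debt_wf M \<longleftrightarrow>
     (\<forall>L\<in>tiers M. \<forall>\<omega>.
        finite (pay_times M L \<omega>) \<and>
        debt M L \<omega> (entry_time M) = (L - 1) * collateral M \<and>
        (\<forall>t. 0 \<le> rate M \<omega> t) \<and> (\<forall>t. 0 \<le> debt M L \<omega> t) \<and>
        (\<forall>t\<in>{decision_time M L..decision_time M L + horizon M L}. positive_until M L \<omega> t \<longrightarrow>
           (\<lambda>s. rate M \<omega> s * debt M L \<omega> s) integrable_on {decision_time M L..t} \<and>
           debt M L \<omega> t = max 0 (gross_debt M L \<omega> t - paid M L \<omega> t)))"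

definition H_up :: "'w market \<Rightarrow> real \<Rightarrow> ereal" where
  "H_up M L =
     (let u = decision_time M L; \<Delta> = horizon M L in
      (SUP \<omega>\<in>op_set M u \<Delta>. ereal (paid M L \<omega> (u + \<Delta>) + debt M L \<omega> (u + \<Delta>))))"

section \<open>Feasibility\<close>

definition Psi :: "'w market \<Rightarrow> real \<Rightarrow> ereal" where
  "Psi M L = ereal (K0 M L) + B_low M (decision_time M L) (horizon M L) (q0 M L)
             - H_up M L - ereal (buffer M L)"

definition L_exact :: "'w market \<Rightarrow> real set" where
  "L_exact M = {L \<in> tiers M. 0 \<le> Psi M L}"

definition feasible_cap :: "'w market \<Rightarrow> real \<Rightarrow> real \<Rightarrow> bool" where
  "feasible_cap M L x \<longleftrightarrow> x \<in> sale_grid M \<and> x \<le> q0 M L \<and>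
     H_up M L + ereal (buffer M L)
       \<le> ereal (K0 M L) + B_low M (decision_time M L) (horizon M L) x"

definition planned_cap :: "'w market \<Rightarrow> real \<Rightarrow> real" where
  "planned_cap M L = (LEAST x. feasible_cap M L x)"

section \<open>The run of the policy on a path\<close>

text \<open>
  A submitted fill is executed if its order is accepted, the controller is authorised at submission
  and at settlement, and the tokens for it and for all fills settling no later are still there.
\<close>

definition executed :: "'w market \<Rightarrow> real \<Rightarrow> 'w \<Rightarrow> fill set" where
  "executed M L \<omega> =
     {f \<in> submitted M L \<omega>.
        accepts M \<omega> (submit_time f) \<and>
        authorised M L \<omega> (submit_time f) Submit \<and> authorised M L \<omega> (settle_time f) Settle \<and>
        (\<Sum>g\<in>{g \<in> submitted M L \<omega>. settle_time g \<le> settle_time f}. fill_qty g)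
          \<le> q0 M L - tokens_out M L \<omega> (settle_time f)}"

definition settled_qty :: "'w market \<Rightarrow> real \<Rightarrow> 'w \<Rightarrow> real \<Rightarrow> real" where
  "settled_qty M L \<omega> t = (\<Sum>f\<in>{f \<in> executed M L \<omega>. settle_time f \<le> t}. fill_qty f)"

text \<open>
  The dedicated cash is confirmed from the start; the time at which it is tendered counts as a
  receipt time, with increment 0 unless a fill is confirmed at that very time.
\<close>

definition receipt_times :: "'w market \<Rightarrow> real \<Rightarrow> 'w \<Rightarrow> real set" where
  "receipt_times M L \<omega> =
     {decision_time M L<..decision_time M L + horizon M L} \<inter>
     insert (tender_time M L \<omega>) (settle_time ` credited M L \<omega>)"

definition increment :: "'w market \<Rightarrow> real \<Rightarrow> 'w \<Rightarrow> real \<Rightarrow> real" where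
  "increment M L \<omega> s = (\<Sum>f\<in>{f \<in> credited M L \<omega>. settle_time f = s}. net_proceeds f)"

definition debt_before :: "'w market \<Rightarrow> real \<Rightarrow> 'w \<Rightarrow> real \<Rightarrow> real" where
  "debt_before M L \<omega> s =
     (if positive_until M L \<omega> s then max 0 (gross_debt M L \<omega> s - paid_before M L \<omega> s) else 0)"

definition cash_before :: "'w market \<Rightarrow> real \<Rightarrow> 'w \<Rightarrow> real \<Rightarrow> real" where
  "cash_before M L \<omega> s =
     K0 M L + (\<Sum>f\<in>{f \<in> credited M L \<omega>. settle_time f < s}. net_proceeds f)
     - paid_before M L \<omega> s - cash_out M L \<omega> s"

definition debt_first :: "'w market \<Rightarrow> real \<Rightarrow> 'w \<Rightarrow> bool" where
  "debt_first M L \<omega> \<longleftrightarrow>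
     (0 < K0 M L \<longrightarrow> tender_time M L \<omega> \<in> receipt_times M L \<omega>) \<and>
     (\<forall>s\<in>receipt_times M L \<omega>. s \<in> pay_times M L \<omega> \<and>
        pay M L \<omega> s = min (debt_before M L \<omega> s) (cash_before M L \<omega> s + increment M L \<omega> s))"

definition execution_authority :: "'w market \<Rightarrow> real \<Rightarrow> 'w \<Rightarrow> bool" where
  "execution_authority M L \<omega> \<longleftrightarrow>
     (\<forall>t\<in>{decision_time M L..decision_time M L + horizon M L}.
        0 < debt M L \<omega> t \<longrightarrow> (\<forall>a. authorised M L \<omega> t a))"

definition non_escape_priority :: "'w market \<Rightarrow> real \<Rightarrow> 'w \<Rightarrow> bool" where
  "non_escape_priority M L \<omega> \<longleftrightarrow>
     (\<forall>t\<in>{decision_time M L..decision_time M L + horizon M L}.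
        positive_until M L \<omega> t \<longrightarrow> cash_out M L \<omega> t = 0 \<and> tokens_out M L \<omega> t = 0)"

text \<open>
  Observability is the inclusion of the executed in the credited fills; finality is the converse
  inclusion together with the restriction of loan payments to receipt times.
\<close>

definition settlement_finality :: "'w market \<Rightarrow> real \<Rightarrow> 'w \<Rightarrow> bool" where
  "settlement_finality M L \<omega> \<longleftrightarrow>
     (let u = decision_time M L; \<Delta> = horizon M L in
        {f \<in> credited M L \<omega>. settle_time f \<le> u + \<Delta>}
          = {f \<in> executed M L \<omega>. settle_time f \<le> u + \<Delta>} \<and>
        pay_times M L \<omega> \<inter> {u<..u + \<Delta>} \<subseteq> receipt_times M L \<omega>)"

text \<open>
  The controller does not stop while the debt is positive and the settled quantity is below the
  cap: every such fill of the program for the planned cap is submitted for. That the quantity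
  finally settled equals the cap is not required.
\<close>

definition runs_to_planned_cap :: "'w market \<Rightarrow> real \<Rightarrow> 'w \<Rightarrow> bool" where
  "runs_to_planned_cap M L \<omega> \<longleftrightarrow>
     (let u = decision_time M L; \<Delta> = horizon M L; x = planned_cap M L;
          F = program M u \<Delta> x \<omega> in
        submitted M L \<omega> \<subseteq> F \<and>
        (\<forall>f\<in>F. submit_time f \<le> u + \<Delta> \<and> (\<forall>s\<in>{u..submit_time f}. 0 < debt M L \<omega> s) \<and>
                settled_qty M L \<omega> (submit_time f) < x \<longrightarrow> f \<in> submitted M L \<omega>) \<and>
        (\<forall>f\<in>submitted M L \<omega>. settle_time f \<le> u + \<Delta>))"

text \<open>
  The debt identity has no borrowing term, so before extinction new borrowing is already excluded;
  what remains to be excluded is a reopening of the loan after extinction.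
\<close>

definition no_new_borrowing :: "'w market \<Rightarrow> real \<Rightarrow> 'w \<Rightarrow> bool" where
  "no_new_borrowing M L \<omega> \<longleftrightarrow>
     (\<forall>s t. decision_time M L \<le> s \<and> s \<le> t \<and> debt M L \<omega> s = 0 \<longrightarrow> debt M L \<omega> t = 0)"

end

theory Submission
  imports Defs
begin

text \<open>
  The cap inequality bounds payments plus residual debt plus buffer by the dedicated cash plus the
  proceeds of the program, on every operating path. If debt were positive at \<open>u + \<Delta>\<close>, it would
  have been positive throughout, so every fill of the planned program would have been executed and
  credited, and no payment could have been debt-limited: each one swept all the cash on the account.
  Hence the payments would equal the dedicated cash plus the program's proceeds, leaving no room for
  a positive residual debt.
\<close>

section \<open>Feasible sale caps and the cap inequality on single paths\<close>

text \<open>Nonnegativity of \<open>Psi\<close> is the cap inequality at \<open>q0\<close> with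
  terms moved across, but in \<open>ereal\<close> this move is safe only away from \<infinity> -
  \<infinity>. A path in the operating set excludes the two harmful infinities.\<close>

lemma feasible_cap_q0:
  assumes "exit_wf M" "L \<in> L_exact M" "op_set M (decision_time M L) (horizon M L) \<noteq> {}"
  shows "feasible_cap M L (q0 M L)"
proof -
  let ?u = "decision_time M L" and ?d = "horizon M L"
  obtain w where w: "w \<in> op_set M ?u ?d"
    using assms(3) by blast
  have "B_low M ?u ?d (q0 M L) \<le> ereal (B_set M ?u ?d (q0 M L) w)"
    unfolding B_low_def by (rule INF_lower[OF w])
  then have b: "B_low M ?u ?d (q0 M L) \<noteq> \<infinity>"
    by auto
  have "ereal (paid M L w (?u + ?d) + debt M L w (?u + ?d)) \<le> H_up M L"
    unfolding H_up_def Let_def by (rule SUP_upper[OF w])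
  then have h: "H_up M L \<noteq> -\<infinity>"
    by auto
  have "0 \<le> Psi M L"
    using assms(2) by (simp add: L_exact_def)
  \<comment> \<open>The other two infinities, \<open>B_low\<close> = -\<infinity> and
    \<open>H_up\<close> = \<infinity>, would make \<open>Psi\<close> equal to -\<infinity>, so only
    the finite case survives.\<close>
  then have "H_up M L + ereal (buffer M L) \<le> ereal (K0 M L) + B_low M ?u ?d (q0 M L)"
    using b h unfolding Psi_def
    by (cases "B_low M ?u ?d (q0 M L)"; cases "H_up M L") auto
  moreover have "q0 M L \<in> sale_grid M"
    using assms(1,2) by (auto simp: exit_wf_def L_exact_def)
  ultimately show ?thesis
    by (simp add: feasible_cap_def)
qed

text \<open>\<open>LEAST\<close> over the reals says something only if a minimum is attained. Here
  it is: the grid has finitely many points up to \<open>q0\<close>, and the feasible caps lie among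
  them.\<close>

lemma feasible_cap_planned_cap:
  assumes "exit_wf M" "feasible_cap M L x"
  shows "feasible_cap M L (planned_cap M L)"
proof -
  have "{x. feasible_cap M L x} \<subseteq> {x \<in> sale_grid M. x \<le> q0 M L}"
    by (auto simp: feasible_cap_def)
  then have fin: "finite {x. feasible_cap M L x}"
    using assms(1) unfolding exit_wf_def by (meson finite_subset)
  have "planned_cap M L = Min {x. feasible_cap M L x}"
    unfolding planned_cap_def using Min_in[OF fin] Min_le[OF fin] assms(2)
    by (intro Least_equality) blast+
  then show ?thesis
    using Min_in[OF fin] assms(2) by (metis empty_iff mem_Collect_eq)
qed

text \<open>Descends from the two envelopes to a real inequality on one path. It is applied to
  \<open>q0\<close> on all operating paths and to the planned cap on the realized one.\<close>

lemma feasible_cap_bound: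
  assumes "feasible_cap M L x" "w \<in> op_set M (decision_time M L) (horizon M L)"
  defines "t \<equiv> decision_time M L + horizon M L"
  shows "paid M L w t + debt M L w t + buffer M L
           \<le> K0 M L + B_set M (decision_time M L) (horizon M L) x w"
proof -
  let ?u = "decision_time M L" and ?d = "horizon M L"
  have "ereal (paid M L w t + debt M L w t) + ereal (buffer M L) \<le> H_up M L + ereal (buffer M L)"
    unfolding H_up_def Let_def t_def by (intro add_right_mono SUP_upper assms(2))
  also have "\<dots> \<le> ereal (K0 M L) + B_low M ?u ?d x"
    using assms(1) by (simp add: feasible_cap_def)
  also have "\<dots> \<le> ereal (K0 M L) + ereal (B_set M ?u ?d x w)"
    unfolding B_low_def by (intro add_left_mono INF_lower assms(2))
  finally show ?thesis
    by simp
qed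

section \<open>Execution of the planned program\<close>

lemma accepts_before_T_close:
  assumes "entry_time M \<le> t" "ereal t < T_close M w"
  shows "accepts M w t"
proof (rule ccontr)
  assume "\<not> accepts M w t"
  then have "T_close M w \<le> ereal t"
    unfolding T_close_def using assms(1) by (intro INF_lower) simp
  then show False
    using assms(2) by simp
qed

lemma program_wf:
  fixes M :: "'w market" and w :: 'w
  assumes "exit_wf M" "L \<in> tiers M" "x \<in> sale_grid M"
  defines "F \<equiv> program M (decision_time M L) (horizon M L) x w"
  shows "finite F" "(\<Sum>f\<in>F. fill_qty f) \<le> x"
    "f \<in> F \<Longrightarrow> 0 < fill_qty f"
    "f \<in> F \<Longrightarrow> decision_time M L \<le> submit_time f"
    "f \<in> F \<Longrightarrow> submit_time f \<le> settle_time f"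
    "f \<in> F \<Longrightarrow> decision_time M L < settle_time f"
  using assms unfolding exit_wf_def Let_def by blast+

text \<open>
  A run that stops because the cap is settled has already executed the whole program, since the
  quantities of the program are positive and sum to at most the cap.
\<close>

lemma executed_eq_program:
  assumes "exit_wf M" "L \<in> tiers M" "planned_cap M L \<in> sale_grid M" "planned_cap M L \<le> q0 M L"
    and "ereal (decision_time M L + horizon M L) < T_close M w"
    and "execution_authority M L w" "non_escape_priority M L w" "runs_to_planned_cap M L w"
    and pos: "\<And>s. s \<in> {decision_time M L..decision_time M L + horizon M L} \<Longrightarrow> 0 < debt M L w s"
  defines "t \<equiv> decision_time M L + horizon M L"
    and "F \<equiv> program M (decision_time M L) (horizon M L) (planned_cap M L) w"
  shows "executed M L w = {f \<in> F. settle_time f \<le> t}"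
proof
  note wf = program_wf[OF assms(1-3), where w = w, folded F_def]
  have sub: "submitted M L w \<subseteq> F"
    and settles: "\<And>f. f \<in> submitted M L w \<Longrightarrow> settle_time f \<le> t"
    and continues: "\<And>f. \<lbrakk>f \<in> F; submit_time f \<le> t;
        \<forall>s\<in>{decision_time M L..submit_time f}. 0 < debt M L w s;
        settled_qty M L w (submit_time f) < planned_cap M L\<rbrakk> \<Longrightarrow> f \<in> submitted M L w"
    using assms(8) unfolding runs_to_planned_cap_def Let_def t_def F_def by blast+
  have exec_sub: "executed M L w \<subseteq> submitted M L w"
    by (auto simp: executed_def)
  then show "executed M L w \<subseteq> {f \<in> F. settle_time f \<le> t}"
    using sub settles by blast
  show "{f \<in> F. settle_time f \<le> t} \<subseteq> executed M L w"
  proof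
    fix f assume "f \<in> {f \<in> F. settle_time f \<le> t}"
    then have f: "f \<in> F" "settle_time f \<le> t" by auto
    have times: "decision_time M L \<le> submit_time f" "submit_time f \<le> t"
      "decision_time M L \<le> settle_time f"
      using wf(4-6)[OF f(1)] f(2) by linarith+
    show "f \<in> executed M L w"
    proof (cases "settled_qty M L w (submit_time f) < planned_cap M L")
      case True
      have fs: "f \<in> submitted M L w"
        by (rule continues[OF f(1) times(2) _ True])
          (use pos times(2) in \<open>auto simp: t_def\<close>)
      \<comment> \<open>The token condition of \<open>executed\<close>: all submitted fills together
        use at most the planned cap, hence at most \<open>q0\<close>, and no token leaves while the
        debt is positive.\<close>
      have "(\<Sum>g\<in>{g \<in> submitted M L w. settle_time g \<le> settle_time f}. fill_qty g)
              \<le> (\<Sum>g\<in>F. fill_qty g)"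
        using sub wf(1,3) by (intro sum_mono2) (auto intro: less_imp_le)
      also have "\<dots> \<le> q0 M L"
        using wf(2) assms(4) by linarith
      also have "\<dots> = q0 M L - tokens_out M L w (settle_time f)"
        using assms(7) times(3) f(2) pos
        by (simp add: non_escape_priority_def positive_until_def t_def)
      finally have qty: "(\<Sum>g\<in>{g \<in> submitted M L w. settle_time g \<le> settle_time f}. fill_qty g)
              \<le> q0 M L - tokens_out M L w (settle_time f)" .
      have "ereal (submit_time f) \<le> ereal t"
        using times(2) by simp
      also have "\<dots> < T_close M w"
        using assms(5) by (simp add: t_def)
      \<comment> \<open>\<open>T_close\<close> only inspects times from entry on;
        \<open>exit_wf\<close> puts the decision time, and so the submission, in that range.\<close>
      finally have "accepts M w (submit_time f)"
        using assms(1,2) times(1) by (intro accepts_before_T_close) (auto simp: exit_wf_def)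
      moreover have "authorised M L w (submit_time f) a" "authorised M L w (settle_time f) a" for a
        using assms(6) times f(2) pos by (auto simp: execution_authority_def t_def)
      ultimately show ?thesis
        using fs qty by (simp add: executed_def)
    next
      case False
      define E where "E = {g \<in> executed M L w. settle_time g \<le> submit_time f}"
      have EF: "E \<subseteq> F"
        using exec_sub sub by (auto simp: E_def)
      have "(\<Sum>g\<in>F - E. fill_qty g) = (\<Sum>g\<in>F. fill_qty g) - settled_qty M L w (submit_time f)"
        using wf(1) EF by (simp add: sum_diff settled_qty_def E_def)
      then have "\<not> 0 < (\<Sum>g\<in>F - E. fill_qty g)"
        using False wf(2) by linarith
      then have "F - E = {}"
        using wf(1,3) by (metis DiffD1 finite_Diff sum_pos)
      then show ?thesis
        using f(1) by (auto simp: E_def)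
    qed
  qed
qed

lemma settled_qty_le_planned_cap:
  assumes "exit_wf M" "L \<in> tiers M" "planned_cap M L \<in> sale_grid M" "runs_to_planned_cap M L w"
  shows "settled_qty M L w t \<le> planned_cap M L"
proof -
  define F where "F = program M (decision_time M L) (horizon M L) (planned_cap M L) w"
  note wf = program_wf[OF assms(1-3), where w = w, folded F_def]
  have "submitted M L w \<subseteq> F"
    using assms(4) by (simp add: runs_to_planned_cap_def Let_def F_def)
  then have "settled_qty M L w t \<le> (\<Sum>f\<in>F. fill_qty f)"
    unfolding settled_qty_def using wf(1,3)
    by (intro sum_mono2) (auto simp: executed_def intro: less_imp_le)
  then show ?thesis
    using wf(2) by linarith
qed

section \<open>Payments while the debt stays positive\<close>

lemma paid_at_pay_time:
  assumes "finite (pay_times M L w)" "s \<in> pay_times M L w" "decision_time M L < s"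
  shows "paid M L w s = paid_before M L w s + pay M L w s"
proof -
  have "pay_times M L w \<inter> {decision_time M L<..s} =
        insert s (pay_times M L w \<inter> {decision_time M L<..<s})"
    using assms(2,3) by auto
  then show ?thesis
    using assms(1) by (simp add: paid_def paid_before_def)
qed

text \<open>A debt-limited payment would extinguish the debt, so each payment is cash-limited here.\<close>

lemma paid_at_receipt_time:
  assumes "debt_wf M" "L \<in> tiers M" "debt_first M L w" "non_escape_priority M L w"
    and fin: "finite {f \<in> credited M L w. settle_time f \<le> s}"
    and s: "s \<in> receipt_times M L w"
    and pos: "positive_until M L w s" "0 < debt M L w s"
  shows "paid M L w s = K0 M L + (\<Sum>f\<in>{f \<in> credited M L w. settle_time f \<le> s}. net_proceeds f)"
proof -
  have su: "decision_time M L < s" "s \<le> decision_time M L + horizon M L"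
    using s by (auto simp: receipt_times_def)
  have pt: "s \<in> pay_times M L w"
    and pay: "pay M L w s = min (debt_before M L w s) (cash_before M L w s + increment M L w s)"
    using assms(3) s by (auto simp: debt_first_def)
  have debt: "debt M L w s = max 0 (gross_debt M L w s - paid M L w s)"
    using assms(1,2) su pos(1) by (simp add: debt_wf_def)
  have paid: "paid M L w s = paid_before M L w s + pay M L w s"
    using assms(1,2) pt su by (intro paid_at_pay_time) (auto simp: debt_wf_def)
  have "pay M L w s \<noteq> debt_before M L w s"
    using debt paid pos by (auto simp: debt_before_def)
  then have "pay M L w s = cash_before M L w s + increment M L w s"
    using pay by (simp add: min_def split: if_splits)
  moreover have "cash_out M L w s = 0"
    using assms(4) su pos(1) by (simp add: non_escape_priority_def)
  moreover have "{f \<in> credited M L w. settle_time f \<le> s} =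
      {f \<in> credited M L w. settle_time f < s} \<union> {f \<in> credited M L w. settle_time f = s}"
    by auto
  moreover have "(\<Sum>f\<in>{f \<in> credited M L w. settle_time f < s} \<union>
        {f \<in> credited M L w. settle_time f = s}. net_proceeds f) =
      (\<Sum>f\<in>{f \<in> credited M L w. settle_time f < s}. net_proceeds f) + increment M L w s"
    unfolding increment_def
    by (intro sum.union_disjoint) (auto intro: finite_subset[OF _ fin])
  \<comment> \<open>\<open>paid_before\<close> cancels, being added in \<open>paid\<close> and
    subtracted in \<open>cash_before\<close>. The history of earlier payments drops out, so no
    induction over receipt times occurs.\<close>
  ultimately show ?thesis
    using paid by (simp add: cash_before_def)
qed

text \<open>The identity of \<open>paid_at_receipt_time\<close>, taken at the last receipt time,
  already covers every receipt and payment up to \<open>t\<close>. Only an inequality is claimed: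
  without receipts, \<open>K0\<close> is merely known to be nonpositive.\<close>

lemma paid_exhausts_cash:
  assumes "debt_wf M" "L \<in> tiers M" "debt_first M L w" "non_escape_priority M L w"
    and "settlement_finality M L w"
  defines "t \<equiv> decision_time M L + horizon M L"
  assumes fin: "finite {f \<in> credited M L w. settle_time f \<le> t}"
    and after: "\<And>f. f \<in> credited M L w \<Longrightarrow> settle_time f \<le> t \<Longrightarrow> decision_time M L < settle_time f"
    and pos: "\<And>s. s \<in> {decision_time M L..t} \<Longrightarrow> 0 < debt M L w s"
  shows "K0 M L + (\<Sum>f\<in>{f \<in> credited M L w. settle_time f \<le> t}. net_proceeds f) \<le> paid M L w t"
proof (cases "receipt_times M L w = {}")
  case True
  \<comment> \<open>\<open>receipt_times\<close> excludes the decision time itself;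
    \<open>after\<close> ensures that no credited fill settles there or earlier and so escapes
    it.\<close>
  have "{f \<in> credited M L w. settle_time f \<le> t} = {}"
    using True after by (fastforce simp: receipt_times_def t_def)
  \<comment> \<open>Positive dedicated cash would have to be tendered, and the tender would be a
    receipt time.\<close>
  moreover have "K0 M L \<le> 0"
    using True assms(3) by (force simp: debt_first_def)
  moreover have "pay_times M L w \<inter> {decision_time M L<..t} = {}"
    using True assms(5) by (simp add: settlement_finality_def Let_def t_def)
  ultimately show ?thesis
    by (simp only: paid_def sum.empty)
next
  case False
  have "receipt_times M L w \<subseteq>
      insert (tender_time M L w) (settle_time ` {f \<in> credited M L w. settle_time f \<le> t})"
    by (auto simp: receipt_times_def t_def)
  then have finR: "finite (receipt_times M L w)"
    using fin by (meson finite_imageI finite_insert finite_subset)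
  \<comment> \<open>By finality no payment falls in the interval from \<open>s\<close>, exclusive,
    to \<open>t\<close>, and no credited fill settles there, so both sides may be read off at
    \<open>s\<close>.\<close>
  define s where "s = Max (receipt_times M L w)"
  have s: "s \<in> receipt_times M L w"
    unfolding s_def by (rule Max_in[OF finR False])
  have last: "r \<le> s" if "r \<in> receipt_times M L w" for r
    unfolding s_def by (rule Max_ge[OF finR that])
  have su: "decision_time M L < s" "s \<le> t"
    using s by (auto simp: receipt_times_def t_def)
  have "f \<in> credited M L w \<Longrightarrow> settle_time f \<le> t \<Longrightarrow> settle_time f \<le> s" for f
    using after by (intro last) (auto simp: receipt_times_def t_def)
  then have cred: "{f \<in> credited M L w. settle_time f \<le> s} = {f \<in> credited M L w. settle_time f \<le> t}"
    using su(2) by force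
  have "pay_times M L w \<inter> {decision_time M L<..t} \<subseteq> receipt_times M L w"
    using assms(5) by (simp add: settlement_finality_def Let_def t_def)
  then have "pay_times M L w \<inter> {decision_time M L<..t} = pay_times M L w \<inter> {decision_time M L<..s}"
    using last su(2) by force
  then have "paid M L w t = paid M L w s"
    by (simp add: paid_def)
  also have "\<dots> = K0 M L + (\<Sum>f\<in>{f \<in> credited M L w. settle_time f \<le> s}. net_proceeds f)"
    using fin su pos
    by (intro paid_at_receipt_time assms(1-4) s) (auto simp: cred positive_until_def)
  finally show ?thesis
    by (simp add: cred)
qed

section \<open>Extinction of the debt on the realized path\<close>

theorem proposition7p2:
  fixes M :: "'w market" and L :: real and \<omega> :: 'w and u \<Delta> :: real
  assumes "entry_wf M" and "exit_wf M" and "debt_wf M"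
    and "L \<in> L_exact M"
    and "u = decision_time M L" and "\<Delta> = horizon M L"
    and "\<omega> \<in> op_set M u \<Delta>"
    and "T_close M \<omega> > ereal (u + \<Delta>)"
    and "execution_authority M L \<omega>"
    and "non_escape_priority M L \<omega>"
    and "settlement_finality M L \<omega>"
    and "runs_to_planned_cap M L \<omega>"
    and "debt_first M L \<omega>"
    and "no_new_borrowing M L \<omega>"
  shows "(\<forall>\<omega>'\<in>op_set M u \<Delta>.
            paid M L \<omega>' (u + \<Delta>) + debt M L \<omega>' (u + \<Delta>) + buffer M L
              \<le> K0 M L + B_set M u \<Delta> (q0 M L) \<omega>')
       \<and> feasible_cap M L (q0 M L)
       \<and> feasible_cap M L (planned_cap M L)
       \<and> settled_qty M L \<omega> (u + \<Delta>) \<le> planned_cap M L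
       \<and> paid M L \<omega> (u + \<Delta>) + buffer M L \<le> K0 M L + B_set M u \<Delta> (planned_cap M L) \<omega>
       \<and> debt M L \<omega> (u + \<Delta>) = 0"
proof -
  note [simp] = \<open>u = decision_time M L\<close> \<open>\<Delta> = horizon M L\<close>
  let ?x = "planned_cap M L"
  have tier: "L \<in> tiers M"
    using assms(4) by (simp add: L_exact_def)
  have cap_q0: "feasible_cap M L (q0 M L)"
    using assms(2,4,7) by (intro feasible_cap_q0) auto
  have cap: "feasible_cap M L ?x"
    by (rule feasible_cap_planned_cap[OF assms(2) cap_q0])
  then have x: "?x \<in> sale_grid M" "?x \<le> q0 M L"
    by (simp_all add: feasible_cap_def)
  have bound: "paid M L \<omega> (u + \<Delta>) + debt M L \<omega> (u + \<Delta>) + buffer M L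
      \<le> K0 M L + B_set M u \<Delta> ?x \<omega>"
    using feasible_cap_bound[OF cap, of \<omega>] assms(7) by simp
  have debt_nonneg: "0 \<le> debt M L \<omega> (u + \<Delta>)"
    using assms(3) tier by (auto simp: debt_wf_def)
  have "debt M L \<omega> (u + \<Delta>) = 0"
  proof (rule ccontr)
    assume ne: "debt M L \<omega> (u + \<Delta>) \<noteq> 0"
    \<comment> \<open>Positivity propagates backwards: a debt that had reached zero at
      \<open>s\<close> would, without new borrowing, still be zero at the horizon.\<close>
    have pos: "0 < debt M L \<omega> s" if "s \<in> {decision_time M L..u + \<Delta>}" for s
    proof -
      have "debt M L \<omega> s \<noteq> 0"
        using assms(14) ne that unfolding no_new_borrowing_def by fastforce
      moreover have "0 \<le> debt M L \<omega> s"
        using assms(3) tier by (auto simp: debt_wf_def)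
      ultimately show ?thesis
        by simp
    qed
    define F where "F = program M u \<Delta> ?x \<omega>"
    note wf = program_wf[OF assms(2) tier x(1), where w = \<omega>]
    have "executed M L \<omega> = {f \<in> F. settle_time f \<le> u + \<Delta>}"
      using executed_eq_program[OF assms(2) tier x _ assms(9,10,12)] assms(8) pos
      by (simp add: F_def)
    then have cred: "{f \<in> credited M L \<omega>. settle_time f \<le> u + \<Delta>} = {f \<in> F. settle_time f \<le> u + \<Delta>}"
      using assms(11) by (auto simp: settlement_finality_def Let_def)
    have "K0 M L + (\<Sum>f\<in>{f \<in> credited M L \<omega>. settle_time f \<le> u + \<Delta>}. net_proceeds f)
        \<le> paid M L \<omega> (u + \<Delta>)"
    proof -
      have "finite {f \<in> credited M L \<omega>. settle_time f \<le> u + \<Delta>}"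
        unfolding cred using wf(1) by (simp add: F_def)
      moreover have "decision_time M L < settle_time f"
        if "f \<in> credited M L \<omega>" "settle_time f \<le> u + \<Delta>" for f
      proof -
        have "f \<in> F"
          using that cred by blast
        then show ?thesis
          using wf(6) by (simp add: F_def)
      qed
      ultimately show ?thesis
        using paid_exhausts_cash[OF assms(3) tier assms(13,10,11)] pos by simp
    qed
    \<comment> \<open>\<open>B_set\<close> sums over exactly the program fills settling by the
      horizon, which \<open>cred\<close> identifies with the credited ones.\<close>
    then have "K0 M L + B_set M u \<Delta> ?x \<omega> \<le> paid M L \<omega> (u + \<Delta>)"
      unfolding cred by (simp add: B_set_def F_def)
    moreover have "0 \<le> buffer M L"
      using assms(2) tier by (auto simp: exit_wf_def)
    \<comment> \<open>Together with \<open>bound\<close> this leaves debt plus buffer at most 0,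
      while the buffer is nonnegative and the debt positive.\<close>
    ultimately show False
      using bound debt_nonneg ne by linarith
  qed
  moreover have "\<forall>\<omega>'\<in>op_set M u \<Delta>. paid M L \<omega>' (u + \<Delta>) + debt M L \<omega>' (u + \<Delta>) + buffer M L
      \<le> K0 M L + B_set M u \<Delta> (q0 M L) \<omega>'"
    using feasible_cap_bound[OF cap_q0] by simp
  moreover have "settled_qty M L \<omega> (u + \<Delta>) \<le> ?x"
    by (rule settled_qty_le_planned_cap[OF assms(2) tier x(1) assms(12)])
  ultimately show ?thesis
    using cap_q0 cap bound by simp
qed

end
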